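(* Let $X=\ell_1^n$ or $X=\ell_\infty^n$ (real), and let $x,y\in S_X$. Then $x\perp_{SB}y$ if and only if the following two conditions hold: (a) $\rho_+(x,y)>0$, (b) $\rho_-(x,y)<0$.
   Context: $\ell_1^n$ and $\ell_\infty^n$ denote $\mathbb{R}^n$ with the norms $\|x\|=\sum_{i}|x_i|$ and $\|x\|=\max_i|x_i|$ respectively. $S_X=\{x\in X:\|x\|=1\}$. For $x,y\in X$, $\rho_{\pm}(x,y)=\lim_{\lambda\to 0^{\pm}}\frac{\|x+\lambda y\|-\|x\|}{\lambda}$. For nonzero $x,y\in X$, strong Birkhoff-James orthogonality $x\perp_{SB}y$ means $\|x+\lambda y\|>\|x\|$ for all real $\lambda\neq 0$. *)

theory Defs
  imports "HOL-Analysis.Analysis"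
begin

text \<open>The norm of the type \<^typ>\<open>real ^ 'n\<close> is the Euclidean one, so normed spaces on
  $\mathbb{R}^n$ are represented here by an explicit norm function \<open>N\<close>:
  \<open>l1_norm\<close> for $\ell_1^n$ and the library's \<^const>\<open>infnorm\<close> for $\ell_\infty^n$.\<close>

definition l1_norm :: "real ^ 'n \<Rightarrow> real" where
  "l1_norm x = (\<Sum>i\<in>UNIV. \<bar>x $ i\<bar>)"

lemma infnorm_eq_Max_components:
  fixes x :: "real ^ 'n"
  shows "infnorm x = Max (range (\<lambda>i. \<bar>x $ i\<bar>))"
proof -
  have "{\<bar>x $ i\<bar> |i. i \<in> UNIV} = range (\<lambda>i. \<bar>x $ i\<bar>)" by auto
  then show ?thesis
    by (simp add: infnorm_cart cSup_eq_Max)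
qed

definition unit_sphere :: "('a::real_vector \<Rightarrow> real) \<Rightarrow> 'a set" where
  "unit_sphere N = {x. N x = 1}"

text \<open>For a norm \<open>N\<close> the one-sided limits below exist by convexity of
  \<open>\<lambda>t. N (x + t *\<^sub>R y)\<close>.\<close>

definition rho_plus :: "('a::real_vector \<Rightarrow> real) \<Rightarrow> 'a \<Rightarrow> 'a \<Rightarrow> real" where
  "rho_plus N x y = Lim (at_right 0) (\<lambda>t. (N (x + t *\<^sub>R y) - N x) / t)"

definition rho_minus :: "('a::real_vector \<Rightarrow> real) \<Rightarrow> 'a \<Rightarrow> 'a \<Rightarrow> real" where
  "rho_minus N x y = Lim (at_left 0) (\<lambda>t. (N (x + t *\<^sub>R y) - N x) / t)"

text \<open>Strong Birkhoff-James orthogonality, meant for nonzero \<open>x\<close> and \<open>y\<close>.\<close>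

definition strong_BJ_orthogonal :: "('a::real_vector \<Rightarrow> real) \<Rightarrow> 'a \<Rightarrow> 'a \<Rightarrow> bool" where
  "strong_BJ_orthogonal N x y \<longleftrightarrow> (\<forall>t::real. t \<noteq> 0 \<longrightarrow> N (x + t *\<^sub>R y) > N x)"

end

theory Submission
  imports Defs
begin

text \<open>Both norms are convex, and both are polyhedral: they arise from absolute values of
  coordinates by finitely many sums or maxima. Along a ray starting at \<open>x\<close> a polyhedral norm is
  therefore affine for small parameters, \<open>N (x + t *\<^sub>R y) = N x + t * c\<close>
  (\<open>right_affine_l1_norm\<close>, \<open>right_affine_infnorm\<close>), and the slope \<open>c\<close> is \<open>\<rho>\<^sub>+\<close>.

  For a general convex norm a positive one-sided derivative forces strict growth along the
  whole ray, but strict growth is compatible with a vanishing derivative (the Euclidean norm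
  in orthogonal directions). Affinity near \<open>0\<close> excludes this: there, strict growth means exactly
  that the slope is positive. This is \<open>strict_growth_iff_slope_pos\<close>. The theorem follows by
  applying it to the two rays in the directions \<open>y\<close> and \<open>- y\<close>, since \<open>\<rho>\<^sub>-\<close> in direction
  \<open>y\<close> is the negated slope in direction \<open>- y\<close>.\<close>

definition right_affine_with :: "real \<Rightarrow> (real \<Rightarrow> real) \<Rightarrow> bool" where
  "right_affine_with c f \<longleftrightarrow> (\<forall>\<^sub>F t in at_right 0. f t = f 0 + t * c)"

definition right_affine :: "(real \<Rightarrow> real) \<Rightarrow> bool" where
  "right_affine f \<longleftrightarrow> (\<exists>c. right_affine_with c f)"

lemma right_affine_with_add:
  assumes "right_affine_with c f" and "right_affine_with d g"
  shows "right_affine_with (c + d) (\<lambda>t. f t + g t)"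
  using assms unfolding right_affine_with_def
  by eventually_elim (simp add: algebra_simps)

text \<open>A strict inequality between the values at \<open>0\<close> persists for small \<open>t\<close>.\<close>

lemma right_affine_with_max_less:
  assumes f: "right_affine_with c f" and g: "right_affine_with d g" and less: "f 0 < g 0"
  shows "right_affine_with d (\<lambda>t. max (f t) (g t))"
proof -
  have "((\<lambda>t. g 0 - f 0 + t * (d - c)) \<longlongrightarrow> g 0 - f 0 + 0 * (d - c)) (at_right 0)"
    by (intro tendsto_intros)
  then have "\<forall>\<^sub>F t in at_right 0. 0 < g 0 - f 0 + t * (d - c)"
    by (rule order_tendstoD(1)) (use less in simp)
  with f g show ?thesis
    unfolding right_affine_with_def
    by eventually_elim (use less in \<open>simp add: algebra_simps\<close>)
qed

text \<open>If the values at \<open>0\<close> agree, the larger slope decides which function is the maximum.\<close>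

lemma right_affine_with_max_eq:
  assumes f: "right_affine_with c f" and g: "right_affine_with d g" and eq: "f 0 = g 0"
  shows "right_affine_with (max c d) (\<lambda>t. max (f t) (g t))"
  using f g eventually_at_right_less[of 0] unfolding right_affine_with_def
  by eventually_elim (simp add: eq max_add_distrib_right max_mult_distrib_left)

lemma right_affine_max:
  assumes "right_affine f" and "right_affine g"
  shows "right_affine (\<lambda>t. max (f t) (g t))"
proof -
  obtain c d where c: "right_affine_with c f" and d: "right_affine_with d g"
    using assms unfolding right_affine_def by blast
  consider "f 0 < g 0" | "f 0 = g 0" | "g 0 < f 0" by linarith
  then show ?thesis
  proof cases
    case 1
    with right_affine_with_max_less[OF c d] show ?thesis by (auto simp: right_affine_def)
  next
    case 2
    with right_affine_with_max_eq[OF c d] show ?thesis by (auto simp: right_affine_def)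
  next
    case 3
    with right_affine_with_max_less[OF d c] show ?thesis
      by (auto simp: right_affine_def max.commute)
  qed
qed

lemma right_affine_abs: "right_affine (\<lambda>t. \<bar>a + t * b\<bar>)"
proof -
  have "right_affine (\<lambda>t. a + t * b)" "right_affine (\<lambda>t. - (a + t * b))"
    unfolding right_affine_def right_affine_with_def
    by (rule exI[of _ b], simp) (rule exI[of _ "- b"], simp)
  moreover have "\<bar>r\<bar> = max r (- r)" for r :: real by linarith
  ultimately show ?thesis using right_affine_max by presburger
qed

lemma right_affine_sum:
  assumes "finite I" and "\<And>i. i \<in> I \<Longrightarrow> right_affine (f i)"
  shows "right_affine (\<lambda>t. \<Sum>i\<in>I. f i t)"
  using assms
proof (induction I rule: finite_induct)
  case empty
  show ?case by (auto simp: right_affine_def right_affine_with_def intro: exI[of _ 0])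
next
  case (insert i I)
  then show ?case
    using right_affine_with_add by (fastforce simp: right_affine_def)
qed

lemma right_affine_Max:
  assumes "finite I" and "I \<noteq> {}" and "\<And>i. i \<in> I \<Longrightarrow> right_affine (f i)"
  shows "right_affine (\<lambda>t. Max ((\<lambda>i. f i t) ` I))"
  using assms
proof (induction I rule: finite_ne_induct)
  case (insert i I)
  then show ?case by (simp add: right_affine_max)
qed simp

lemma right_affine_l1_norm: "right_affine (\<lambda>t. l1_norm (x + t *\<^sub>R y))"
  unfolding l1_norm_def by (simp add: right_affine_sum right_affine_abs)

lemma right_affine_infnorm:
  fixes x y :: "real ^ 'n"
  shows "right_affine (\<lambda>t. infnorm (x + t *\<^sub>R y))"
  unfolding infnorm_eq_Max_components by (simp add: right_affine_Max right_affine_abs)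

lemma convex_on_l1_norm: "convex_on UNIV l1_norm"
proof (rule convex_onI)
  fix t :: real and x y :: "real ^ 'n"
  assume t: "0 < t" "t < 1"
  have "\<bar>(1 - t) * x $ i + t * y $ i\<bar> \<le> (1 - t) * \<bar>x $ i\<bar> + t * \<bar>y $ i\<bar>" for i
    using abs_triangle_ineq[of "(1 - t) * x $ i" "t * y $ i"] t by (simp add: abs_mult)
  then show "l1_norm ((1 - t) *\<^sub>R x + t *\<^sub>R y) \<le> (1 - t) * l1_norm x + t * l1_norm y"
    unfolding l1_norm_def by (simp add: sum_distrib_left sum_mono flip: sum.distrib)
qed simp

lemma convex_on_infnorm: "convex_on UNIV infnorm"
proof (rule convex_onI)
  fix t :: real and x y :: 'a
  assume t: "0 < t" "t < 1"
  show "infnorm ((1 - t) *\<^sub>R x + t *\<^sub>R y) \<le> (1 - t) * infnorm x + t * infnorm y"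
    using infnorm_triangle[of "(1 - t) *\<^sub>R x" "t *\<^sub>R y"] t by (simp add: infnorm_mul)
qed simp

text \<open>Left to right, a single small \<open>t\<close> in the affine range shows the sign of the slope. Right
  to left, \<open>x + s *\<^sub>R y\<close> for a small \<open>s\<close> lies between \<open>x\<close> and \<open>x + t *\<^sub>R y\<close>, and by convexity the
  chord to \<open>x + t *\<^sub>R y\<close> is at least as steep as the one to \<open>x + s *\<^sub>R y\<close>.\<close>

lemma strict_growth_iff_slope_pos:
  fixes N :: "'a::real_vector \<Rightarrow> real"
  assumes convex: "convex_on UNIV N"
    and affine: "right_affine_with c (\<lambda>t. N (x + t *\<^sub>R y))"
  shows "(\<forall>t>0. N x < N (x + t *\<^sub>R y)) \<longleftrightarrow> 0 < c"
proof
  assume growth: "\<forall>t>0. N x < N (x + t *\<^sub>R y)"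
  have "\<forall>\<^sub>F t in at_right 0. 0 < t \<and> N (x + t *\<^sub>R y) = N x + t * c"
    using affine eventually_at_right_less[of 0] unfolding right_affine_with_def
    by eventually_elim simp
  then obtain t where t: "0 < t" and eq: "N (x + t *\<^sub>R y) = N x + t * c"
    using eventually_happens'[OF trivial_limit_at_right_real] by blast
  have "0 < t * c" using growth t eq by fastforce
  with t show "0 < c" by (simp add: zero_less_mult_iff)
next
  assume c: "0 < c"
  show "\<forall>t>0. N x < N (x + t *\<^sub>R y)"
  proof (intro allI impI)
    fix t :: real
    assume t: "0 < t"
    have "\<forall>\<^sub>F s in at_right 0. 0 < s \<and> s < t \<and> N (x + s *\<^sub>R y) = N x + s * c"
      using affine eventually_at_right_less[of 0] eventually_at_right_real[OF t]
      unfolding right_affine_with_def by eventually_elim simp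
    then obtain s where s: "0 < s" "s < t" and eq: "N (x + s *\<^sub>R y) = N x + s * c"
      using eventually_happens'[OF trivial_limit_at_right_real] by blast
    have "x + s *\<^sub>R y = (1 - s / t) *\<^sub>R x + (s / t) *\<^sub>R (x + t *\<^sub>R y)"
      using t by (simp add: algebra_simps)
    then have "N x + s * c \<le> (1 - s / t) * N x + (s / t) * N (x + t *\<^sub>R y)"
      using convex_onD[OF convex, of "s / t" x "x + t *\<^sub>R y"] s eq by simp
    then have "s * c \<le> (s / t) * (N (x + t *\<^sub>R y) - N x)"
      by (simp add: algebra_simps)
    moreover have "0 < s * c" and "0 < s / t" using s t c by simp_all
    ultimately have "0 < N (x + t *\<^sub>R y) - N x"
      by (meson less_le_trans zero_less_mult_pos)
    then show "N x < N (x + t *\<^sub>R y)" by simp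
  qed
qed

lemma tendsto_right_slope:
  fixes N :: "'a::real_vector \<Rightarrow> real"
  assumes "right_affine_with c (\<lambda>t. N (x + t *\<^sub>R y))"
  shows "((\<lambda>t. (N (x + t *\<^sub>R y) - N x) / t) \<longlongrightarrow> c) (at_right 0)"
proof (rule tendsto_eventually)
  show "\<forall>\<^sub>F t in at_right 0. (N (x + t *\<^sub>R y) - N x) / t = c"
    using assms eventually_at_right_less[of 0] unfolding right_affine_with_def
    by eventually_elim simp
qed

lemma rho_plus_eq_slope:
  fixes N :: "'a::real_vector \<Rightarrow> real"
  assumes "right_affine_with c (\<lambda>t. N (x + t *\<^sub>R y))"
  shows "rho_plus N x y = c"
  unfolding rho_plus_def
  by (intro tendsto_Lim tendsto_right_slope assms) simp

lemma rho_minus_eq_slope: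
  fixes N :: "'a::real_vector \<Rightarrow> real"
  assumes "right_affine_with c (\<lambda>t. N (x + t *\<^sub>R (- y)))"
  shows "rho_minus N x y = - c"
  unfolding rho_minus_def
proof (rule tendsto_Lim)
  show "((\<lambda>t. (N (x + t *\<^sub>R y) - N x) / t) \<longlongrightarrow> - c) (at_left 0)"
    using tendsto_minus[OF tendsto_right_slope[OF assms]]
    by (simp add: filterlim_at_left_to_right)
qed simp

text \<open>The two rays from \<open>x\<close> in the directions \<open>y\<close> and \<open>- y\<close> make up the line.\<close>

lemma strong_BJ_orthogonal_iff_rays:
  "strong_BJ_orthogonal N x y \<longleftrightarrow>
    (\<forall>t>0. N x < N (x + t *\<^sub>R y)) \<and> (\<forall>t>0. N x < N (x + t *\<^sub>R (- y)))"
proof (intro iffI conjI allI impI)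
  fix t :: real
  assume "strong_BJ_orthogonal N x y" and "0 < t"
  then have "N x < N (x + t *\<^sub>R y)" "N x < N (x + (- t) *\<^sub>R y)"
    unfolding strong_BJ_orthogonal_def
    by (metis less_irrefl, metis less_irrefl neg_equal_0_iff_equal)
  then show "N x < N (x + t *\<^sub>R y)" "N x < N (x + t *\<^sub>R (- y))" by simp_all
next
  assume rays: "(\<forall>t>0. N x < N (x + t *\<^sub>R y)) \<and> (\<forall>t>0. N x < N (x + t *\<^sub>R (- y)))"
  show "strong_BJ_orthogonal N x y"
    unfolding strong_BJ_orthogonal_def
  proof (intro allI impI)
    fix t :: real
    assume "t \<noteq> 0"
    then consider "0 < t" | "0 < - t" by linarith
    then show "N x < N (x + t *\<^sub>R y)"
    proof cases
      case 2
      with rays have "N x < N (x + (- t) *\<^sub>R (- y))" by blast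
      then show ?thesis by simp
    qed (use rays in blast)
  qed
qed

theorem theorem2p7:
  fixes N :: "real ^ 'n \<Rightarrow> real" and x y :: "real ^ 'n"
  assumes "N = l1_norm \<or> N = infnorm"
    and "x \<in> unit_sphere N" and "y \<in> unit_sphere N"
  shows "strong_BJ_orthogonal N x y \<longleftrightarrow> rho_plus N x y > 0 \<and> rho_minus N x y < 0"
proof -
  have convex: "convex_on UNIV N"
    using assms(1) convex_on_l1_norm convex_on_infnorm by blast
  have "right_affine (\<lambda>t. N (x + t *\<^sub>R z))" for z
    using assms(1) right_affine_l1_norm right_affine_infnorm by blast
  then obtain c d where c: "right_affine_with c (\<lambda>t. N (x + t *\<^sub>R y))"
    and d: "right_affine_with d (\<lambda>t. N (x + t *\<^sub>R (- y)))"
    unfolding right_affine_def by blast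
  show ?thesis
    unfolding strong_BJ_orthogonal_iff_rays
      strict_growth_iff_slope_pos[OF convex c] strict_growth_iff_slope_pos[OF convex d]
      rho_plus_eq_slope[OF c] rho_minus_eq_slope[OF d]
    by simp
qed

end
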